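(* In the binary-outcome model, the parameters $\theta_1,\theta_2,\ldots,\theta_{K_1},\gamma_1,\gamma_2,\ldots,\gamma_{K_2},\rho$ can be identified under the assumption that $\delta_2=\rho h(\delta_1)$ holds.
   Context: Setting. One observes $n$ i.i.d. copies of $(Z,C,X,Y)$: $Z$ an instrumental variable, $C$ an observed covariate (each possibly multi-dimensional), $X$ a continuous real exposure, $Y\in\{0,1\}$ a binary outcome; $U$ is an unobserved confounder. The model is $$X=\beta_{X0}+\beta_ZZ+\beta_CC+\delta_1,\qquad \mathrm{logit}(P(Y=1))=\beta_{Y0}+\sum_{j=1}^{K_1}\theta_jf_j(X)+\sum_{j=1}^{K_2}\gamma_jg_j(C)+\delta_2,$$ where $P(Y=1)$ is conditional on the variables on the right-hand side, $\mathrm{logit}(p)=\log\frac{p}{1-p}$, $\delta_1=\beta_UU+\epsilon_X$ (with $\epsilon_X$ a mean-zero error independent of $Z,C,U$), and $\delta_2$ is the contribution of unobserved variables (confounding) to the outcome. The $f_j,g_j$ are known basis functions, $K_1,K_2\ge1$; $1,f_1(X),\dots,f_{K_1}(X)$ are linearly independent, $1,g_1(C),\dots,g_{K_2}(C)$ are linearly independent, and the instruments (resp. covariates), if several, are linearly independent. The instrument has a direct effect on $X$ ($\beta_Z\ne0$), $Z$ is independent of $U$, and $Z$ has no direct effect on $Y$. Also $C$ is independent of $Z$ and of $U$. The function $h$ is a known continuous function of $\delta_1$; under $\delta_2=\rho h(\delta_1)$, $$\mathrm{logit}(P(Y=1))=\beta_{Y0}+\sum_{j=1}^{K_1}\theta_jf_j(X)+\sum_{j=1}^{K_2}\gamma_jg_j(C)+\rho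 h(\delta_1).$$ Estimation: in the first stage regress $X$ linearly on $Z$ and $C$ (with intercept) to get residuals $\hat\delta_1$; in the second stage fit the logistic regression of $Y$ on $f_1(X),\dots,f_{K_1}(X),g_1(C),\dots,g_{K_2}(C),h(\hat\delta_1)$ with intercept. The listed parameters are identified if they are uniquely determined by the second-stage logistic regression.
   Formalization: Added, as the claim fails otherwise: h(δ₁) is not a.s. constant; no nonzero combination of the f_j(X) is constant as Z varies with C, δ₁ fixed; β_U U has mean zero; δ₁ has finite variance. Regressions are population ones; Z, C, U, ε_X are mutually independent. *)

theory Defs
  imports "HOL-Probability.Probability"
begin

text \<open>
  Regressions are understood at population level: each is the minimisation of the expectation of the
  criterion that the empirical regression minimises over the sample. Both criteria depend on the
  joint law of the observed variables only. They are written as nonnegative integrals, so that a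
  non-integrable criterion has the value infinity.
\<close>

definition logit :: "real \<Rightarrow> real" where
  "logit p = ln (p / (1 - p))"

definition cond_prob_given ::
  "'w measure \<Rightarrow> ('w \<Rightarrow> 'v::topological_space) \<Rightarrow> 'w set \<Rightarrow> 'w \<Rightarrow> real" where
  "cond_prob_given M V A = real_cond_exp M (vimage_algebra (space M) V borel) (indicator A)"

text \<open>
  Independence of the generated sigma-algebras; \<open>indep_var\<close> requires both variables to have
  the same type.
\<close>
definition indep_rv ::
  "'w measure \<Rightarrow> ('w \<Rightarrow> 'a::topological_space) \<Rightarrow> ('w \<Rightarrow> 'b::topological_space) \<Rightarrow> bool" where
  "indep_rv M A B \<longleftrightarrow> prob_space.indep_set M
     (sets (vimage_algebra (space M) A borel)) (sets (vimage_algebra (space M) B borel))"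

definition lin_indep_rv :: "'w measure \<Rightarrow> ('i::finite \<Rightarrow> 'w \<Rightarrow> real) \<Rightarrow> bool" where
  "lin_indep_rv M V \<longleftrightarrow>
     (\<forall>a. (AE \<omega> in M. (\<Sum>i\<in>UNIV. a i * V i \<omega>) = 0) \<longrightarrow> (\<forall>i. a i = 0))"

definition with_one :: "('i \<Rightarrow> 'w \<Rightarrow> real) \<Rightarrow> 'i option \<Rightarrow> 'w \<Rightarrow> real" where
  "with_one V = case_option (\<lambda>_. 1) V"

text \<open>
  Linear independence of the \<open>f j (X)\<close> along the instrument: \<open>W\<close> is the part of the exposure not
  driven by the instrument and \<open>T\<close> the part driven by it. For almost every value of \<open>W\<close>, held fixed,
  let \<open>T\<close> run through its distribution; no nonzero combination of the \<open>f j\<close> may then be constant in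
  \<open>T\<close> (with a constant depending on \<open>W\<close>). Nonvanishing of the first-stage coefficient together with
  unconditional linear independence does not imply this: if \<open>T\<close> takes the values 0 and 1 and
  \<open>f\<close> is \<open>\<lambda>x. cos (2 * pi * x)\<close>, then \<open>f (W + T) = f W\<close>.
\<close>
definition lin_indep_along_instrument ::
  "'w measure \<Rightarrow> ('k::finite \<Rightarrow> real \<Rightarrow> real) \<Rightarrow> ('w \<Rightarrow> real) \<Rightarrow> ('w \<Rightarrow> real) \<Rightarrow> bool" where
  "lin_indep_along_instrument M f W T \<longleftrightarrow>
     (\<forall>a. (AE \<omega> in M. \<exists>c. AE \<omega>' in M. (\<Sum>j\<in>UNIV. a j * f j (W \<omega> + T \<omega>')) = c)
          \<longrightarrow> (\<forall>j. a j = 0))"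

definition first_stage_residual ::
  "('w \<Rightarrow> real^'p) \<Rightarrow> ('w \<Rightarrow> real^'q) \<Rightarrow> ('w \<Rightarrow> real) \<Rightarrow> real \<Rightarrow> real^'p \<Rightarrow> real^'q \<Rightarrow> 'w \<Rightarrow> real" where
  "first_stage_residual Z C X b0 bZ bC \<omega> = X \<omega> - (b0 + bZ \<bullet> Z \<omega> + bC \<bullet> C \<omega>)"

definition first_stage_risk ::
  "'w measure \<Rightarrow> ('w \<Rightarrow> real^'p) \<Rightarrow> ('w \<Rightarrow> real^'q) \<Rightarrow> ('w \<Rightarrow> real)
     \<Rightarrow> real \<Rightarrow> real^'p \<Rightarrow> real^'q \<Rightarrow> ennreal" where
  "first_stage_risk M Z C X b0 bZ bC =
     (\<integral>\<^sup>+ \<omega>. ennreal ((first_stage_residual Z C X b0 bZ bC \<omega>)\<^sup>2) \<partial>M)"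

definition first_stage_fit ::
  "'w measure \<Rightarrow> ('w \<Rightarrow> real^'p) \<Rightarrow> ('w \<Rightarrow> real^'q) \<Rightarrow> ('w \<Rightarrow> real)
     \<Rightarrow> real \<Rightarrow> real^'p \<Rightarrow> real^'q \<Rightarrow> bool" where
  "first_stage_fit M Z C X b0 bZ bC \<longleftrightarrow>
     (\<forall>b0' bZ' bC'. first_stage_risk M Z C X b0 bZ bC \<le> first_stage_risk M Z C X b0' bZ' bC')"

text \<open>
  Minus the Bernoulli log-likelihood of \<open>y \<in> {0, 1}\<close> at success probability
  \<open>exp \<eta> / (1 + exp \<eta>)\<close>, i.e. at log-odds \<open>\<eta>\<close>; it is nonnegative.
\<close>
definition logistic_loss :: "real \<Rightarrow> real \<Rightarrow> real" where
  "logistic_loss y \<eta> = ln (1 + exp \<eta>) - y * \<eta>"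

definition linear_predictor ::
  "('k1::finite \<Rightarrow> real \<Rightarrow> real) \<Rightarrow> ('k2::finite \<Rightarrow> real^'q \<Rightarrow> real)
     \<Rightarrow> real \<Rightarrow> ('k1 \<Rightarrow> real) \<Rightarrow> ('k2 \<Rightarrow> real) \<Rightarrow> real \<Rightarrow> real^'q \<Rightarrow> real" where
  "linear_predictor f g b0 \<theta> \<gamma> x c =
     b0 + (\<Sum>j\<in>UNIV. \<theta> j * f j x) + (\<Sum>j\<in>UNIV. \<gamma> j * g j c)"

definition second_stage_risk ::
  "'w measure \<Rightarrow> ('w \<Rightarrow> real^'q) \<Rightarrow> ('w \<Rightarrow> real) \<Rightarrow> ('w \<Rightarrow> real) \<Rightarrow> ('w \<Rightarrow> real)
     \<Rightarrow> ('k1::finite \<Rightarrow> real \<Rightarrow> real) \<Rightarrow> ('k2::finite \<Rightarrow> real^'q \<Rightarrow> real) \<Rightarrow> (real \<Rightarrow> real)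
     \<Rightarrow> real \<Rightarrow> ('k1 \<Rightarrow> real) \<Rightarrow> ('k2 \<Rightarrow> real) \<Rightarrow> real \<Rightarrow> ennreal" where
  "second_stage_risk M C X Y D f g h b0 \<theta> \<gamma> \<rho> =
     (\<integral>\<^sup>+ \<omega>. ennreal (logistic_loss (Y \<omega>)
        (linear_predictor f g b0 \<theta> \<gamma> (X \<omega>) (C \<omega>) + \<rho> * h (D \<omega>))) \<partial>M)"

definition second_stage_fit ::
  "'w measure \<Rightarrow> ('w \<Rightarrow> real^'q) \<Rightarrow> ('w \<Rightarrow> real) \<Rightarrow> ('w \<Rightarrow> real) \<Rightarrow> ('w \<Rightarrow> real)
     \<Rightarrow> ('k1::finite \<Rightarrow> real \<Rightarrow> real) \<Rightarrow> ('k2::finite \<Rightarrow> real^'q \<Rightarrow> real) \<Rightarrow> (real \<Rightarrow> real)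
     \<Rightarrow> real \<Rightarrow> ('k1 \<Rightarrow> real) \<Rightarrow> ('k2 \<Rightarrow> real) \<Rightarrow> real \<Rightarrow> bool" where
  "second_stage_fit M C X Y D f g h b0 \<theta> \<gamma> \<rho> \<longleftrightarrow>
     (\<forall>b0' \<theta>' \<gamma>' \<rho>'. second_stage_risk M C X Y D f g h b0 \<theta> \<gamma> \<rho>
                    \<le> second_stage_risk M C X Y D f g h b0' \<theta>' \<gamma>' \<rho>')"

end

theory Submission
  imports Defs
begin

text \<open>
  Since \<open>\<delta>1\<close> is centred and independent of \<open>(Z, C)\<close>, perturbing the true first-stage coefficients
  adds the second moment of the perturbation to the risk; hence every first-stage fit has residual
  \<open>\<delta>1\<close> almost everywhere, even where its coefficients are not unique. The second-stage risk at a
  predictor \<open>\<eta>\<close> is the expected cross entropy between the true conditional probability of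
  \<open>Y = 1\<close> and the one with log-odds \<open>\<eta>\<close>, so by the equality case of Gibbs' inequality a minimiser
  agrees almost everywhere with the true predictor. Finally, independence of \<open>Z\<close> and \<open>(\<delta>1, C)\<close>
  allows fixing \<open>(\<delta>1, C)\<close> and varying \<open>Z\<close>, which determines the coefficients of the \<open>f j\<close>;
  what remains is a relation between the independent \<open>h \<delta>1\<close> and \<open>C\<close>, which forces the coefficient
  of the nonconstant \<open>h \<delta>1\<close>, and then those of the \<open>g j\<close>.
\<close>

section \<open>Independence of random variables and integration under it\<close>

context prob_space
begin

text \<open>The generated sigma-algebras consist exactly of the preimages of Borel sets. The product
  formula is put in terms of \<open>emeasure\<close>, the form in which it determines a product
  measure.\<close>

lemma indep_rv_iff:
  fixes A :: "'a \<Rightarrow> 'b::topological_space" and B :: "'a \<Rightarrow> 'c::topological_space"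
  assumes [measurable]: "A \<in> borel_measurable M" "B \<in> borel_measurable M"
  shows "indep_rv M A B \<longleftrightarrow>
    (\<forall>S\<in>sets borel. \<forall>T\<in>sets borel.
      emeasure M (A -` S \<inter> space M \<inter> (B -` T \<inter> space M)) =
      emeasure M (A -` S \<inter> space M) * emeasure M (B -` T \<inter> space M))"
proof -
  have sets_A: "sets (vimage_algebra (space M) A borel) = {A -` S \<inter> space M | S. S \<in> sets borel}"
    and sets_B: "sets (vimage_algebra (space M) B borel) = {B -` S \<inter> space M | S. S \<in> sets borel}"
    by (simp_all add: sets_vimage_algebra2)
  show ?thesis
    unfolding indep_rv_def
  proof (intro iffI ballI)
    fix S :: "'b set" and T :: "'c set"
    assume "indep_set (sets (vimage_algebra (space M) A borel)) (sets (vimage_algebra (space M) B borel))"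
      and "S \<in> sets borel" "T \<in> sets borel"
    then have "prob (A -` S \<inter> space M \<inter> (B -` T \<inter> space M)) =
      prob (A -` S \<inter> space M) * prob (B -` T \<inter> space M)"
      by (intro indep_setD) (auto simp: sets_A sets_B)
    then show "emeasure M (A -` S \<inter> space M \<inter> (B -` T \<inter> space M)) =
      emeasure M (A -` S \<inter> space M) * emeasure M (B -` T \<inter> space M)"
      by (simp add: emeasure_eq_measure ennreal_mult)
  next
    assume *: "\<forall>S\<in>sets borel. \<forall>T\<in>sets borel.
      emeasure M (A -` S \<inter> space M \<inter> (B -` T \<inter> space M)) =
      emeasure M (A -` S \<inter> space M) * emeasure M (B -` T \<inter> space M)"
    show "indep_set (sets (vimage_algebra (space M) A borel)) (sets (vimage_algebra (space M) B borel))"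
    proof (rule indep_setI)
      show "sets (vimage_algebra (space M) A borel) \<subseteq> events"
        "sets (vimage_algebra (space M) B borel) \<subseteq> events"
        unfolding sets_A sets_B by auto
      fix a b
      assume "a \<in> sets (vimage_algebra (space M) A borel)" "b \<in> sets (vimage_algebra (space M) B borel)"
      then have "emeasure M (a \<inter> b) = emeasure M a * emeasure M b"
        unfolding sets_A sets_B using * by auto
      then show "prob (a \<inter> b) = prob a * prob b"
        by (simp add: measure_def enn2real_mult)
    qed
  qed
qed

lemma indep_rv_sym:
  assumes "A \<in> borel_measurable M" "B \<in> borel_measurable M" "indep_rv M A B"
  shows "indep_rv M B A"
  using assms by (simp add: indep_rv_iff Int_commute mult.commute)

lemma indep_rv_compose:
  fixes A :: "'a \<Rightarrow> 'b::topological_space" and B :: "'a \<Rightarrow> 'c::topological_space"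
    and \<phi> :: "'b \<Rightarrow> 'd::topological_space" and \<psi> :: "'c \<Rightarrow> 'e::topological_space"
  assumes [measurable]: "A \<in> borel_measurable M" "B \<in> borel_measurable M"
    and AB: "indep_rv M A B"
    and [measurable]: "\<phi> \<in> borel_measurable borel" "\<psi> \<in> borel_measurable borel"
  shows "indep_rv M (\<lambda>\<omega>. \<phi> (A \<omega>)) (\<lambda>\<omega>. \<psi> (B \<omega>))"
proof (subst indep_rv_iff; (intro ballI)?)
  fix S :: "'d set" and T :: "'e set"
  assume "S \<in> sets borel" "T \<in> sets borel"
  then have "\<phi> -` S \<in> sets borel" "\<psi> -` T \<in> sets borel"
    using measurable_sets[OF assms(4)] measurable_sets[OF assms(5)] by auto
  moreover have "(\<lambda>\<omega>. \<phi> (A \<omega>)) -` S = A -` (\<phi> -` S)" "(\<lambda>\<omega>. \<psi> (B \<omega>)) -` T = B -` (\<psi> -` T)"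
    by auto
  ultimately show "emeasure M ((\<lambda>\<omega>. \<phi> (A \<omega>)) -` S \<inter> space M \<inter> ((\<lambda>\<omega>. \<psi> (B \<omega>)) -` T \<inter> space M)) =
    emeasure M ((\<lambda>\<omega>. \<phi> (A \<omega>)) -` S \<inter> space M) * emeasure M ((\<lambda>\<omega>. \<psi> (B \<omega>)) -` T \<inter> space M)"
    using AB[unfolded indep_rv_iff[OF assms(1,2)]] by simp
qed measurable

lemma indep_rv_fst:
  fixes A :: "'a \<Rightarrow> 'b::topological_space"
    and B :: "'a \<Rightarrow> 'c::second_countable_topology"
    and C :: "'a \<Rightarrow> 'd::second_countable_topology"
  assumes A: "A \<in> borel_measurable M"
    and [measurable]: "B \<in> borel_measurable M" "C \<in> borel_measurable M"
    and indep: "indep_rv M A (\<lambda>\<omega>. (B \<omega>, C \<omega>))"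
  shows "indep_rv M A B"
proof -
  have BC: "(\<lambda>\<omega>. (B \<omega>, C \<omega>)) \<in> borel_measurable M" by measurable
  have fst: "fst \<in> borel_measurable (borel :: ('c \<times> 'd) measure)"
    by (intro borel_measurable_continuous_onI continuous_intros)
  have "indep_rv M (\<lambda>\<omega>. (\<lambda>x. x) (A \<omega>)) (\<lambda>\<omega>. fst (B \<omega>, C \<omega>))"
    by (rule indep_rv_compose[OF A BC indep _ fst]) measurable
  then show ?thesis by (simp only: fst_conv)
qed

text \<open>The joint law of \<open>A\<close> and \<open>B\<close> and the product of their laws
  agree on rectangles, hence everywhere, and Tonelli's theorem applies. The inner variable
  \<open>\<omega>'\<close> acts as an independent copy of \<open>\<omega>\<close>.\<close>

lemma indep_rv_nn_integral:
  assumes [measurable]: "A \<in> borel_measurable M" "B \<in> borel_measurable M"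
    and AB: "indep_rv M A B"
    and [measurable]: "F \<in> borel_measurable (borel \<Otimes>\<^sub>M borel)"
  shows "(\<integral>\<^sup>+ \<omega>. F (A \<omega>, B \<omega>) \<partial>M) = (\<integral>\<^sup>+ \<omega>. \<integral>\<^sup>+ \<omega>'. F (A \<omega>, B \<omega>') \<partial>M \<partial>M)"
proof -
  interpret dA: prob_space "distr M borel A" by (rule prob_space_distr) simp
  interpret dB: prob_space "distr M borel B" by (rule prob_space_distr) simp
  have "distr M borel A \<Otimes>\<^sub>M distr M borel B = distr M (borel \<Otimes>\<^sub>M borel) (\<lambda>\<omega>. (A \<omega>, B \<omega>))"
  proof (rule pair_measure_eqI)
    fix S T assume "S \<in> sets (distr M borel A)" "T \<in> sets (distr M borel B)"
    then have [measurable]: "S \<in> sets borel" "T \<in> sets borel" by auto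
    have "(\<lambda>\<omega>. (A \<omega>, B \<omega>)) -` (S \<times> T) \<inter> space M = A -` S \<inter> space M \<inter> (B -` T \<inter> space M)"
      by auto
    then show "emeasure (distr M borel A) S * emeasure (distr M borel B) T =
      emeasure (distr M (borel \<Otimes>\<^sub>M borel) (\<lambda>\<omega>. (A \<omega>, B \<omega>))) (S \<times> T)"
      using AB[unfolded indep_rv_iff[OF assms(1,2)]] by (simp add: emeasure_distr)
  qed (simp_all add: dA.sigma_finite_measure_axioms dB.sigma_finite_measure_axioms)
  then have "(\<integral>\<^sup>+ \<omega>. F (A \<omega>, B \<omega>) \<partial>M) = (\<integral>\<^sup>+ x. F x \<partial>(distr M borel A \<Otimes>\<^sub>M distr M borel B))"
    by (simp add: nn_integral_distr)
  also have "\<dots> = (\<integral>\<^sup>+ x. \<integral>\<^sup>+ y. F (x, y) \<partial>distr M borel B \<partial>distr M borel A)"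
    by (rule dB.nn_integral_fst[symmetric]) (simp cong: measurable_cong_sets)
  also have "\<dots> = (\<integral>\<^sup>+ x. \<integral>\<^sup>+ \<omega>'. F (x, B \<omega>') \<partial>M \<partial>distr M borel A)"
    by (simp add: nn_integral_distr)
  also have "\<dots> = (\<integral>\<^sup>+ \<omega>. \<integral>\<^sup>+ \<omega>'. F (A \<omega>, B \<omega>') \<partial>M \<partial>M)"
    by (rule nn_integral_distr) measurable
  finally show ?thesis .
qed

text \<open>Tonelli for the indicator of the failure of \<open>P\<close>: its double integral
  vanishes, so almost every section is null. This justifies fixing one variable while an independent
  one runs through its law.\<close>

lemma indep_rv_AE:
  assumes [measurable]: "A \<in> borel_measurable M" "B \<in> borel_measurable M"
    and AB: "indep_rv M A B"
    and [measurable]: "Measurable.pred (borel \<Otimes>\<^sub>M borel) P"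
    and ae: "AE \<omega> in M. P (A \<omega>, B \<omega>)"
  shows "AE \<omega> in M. AE \<omega>' in M. P (A \<omega>, B \<omega>')"
proof -
  define F where "F x = (if P x then 0 else 1 :: ennreal)" for x
  have [measurable]: "F \<in> borel_measurable (borel \<Otimes>\<^sub>M borel)"
    unfolding F_def by measurable
  have "(\<integral>\<^sup>+ \<omega>. \<integral>\<^sup>+ \<omega>'. F (A \<omega>, B \<omega>') \<partial>M \<partial>M) = (\<integral>\<^sup>+ \<omega>. F (A \<omega>, B \<omega>) \<partial>M)"
    by (rule indep_rv_nn_integral[symmetric]) (use AB in measurable)
  also have "(\<integral>\<^sup>+ \<omega>. F (A \<omega>, B \<omega>) \<partial>M) = (\<integral>\<^sup>+ \<omega>. 0 \<partial>M)"
    by (rule nn_integral_cong_AE) (use ae in \<open>auto simp: F_def\<close>)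
  finally have "AE \<omega> in M. (\<integral>\<^sup>+ \<omega>'. F (A \<omega>, B \<omega>') \<partial>M) = 0"
    by (simp add: nn_integral_0_iff_AE)
  then show ?thesis
  proof eventually_elim
    case (elim \<omega>)
    have "AE \<omega>' in M. F (A \<omega>, B \<omega>') = 0"
      using elim by (subst (asm) nn_integral_0_iff_AE) auto
    then show ?case
      by eventually_elim (auto simp: F_def split: if_splits)
  qed
qed

text \<open>Integration separates \<open>A\<close> from \<open>(B, C)\<close> first and
  \<open>B\<close> from \<open>C\<close> next; the factor in \<open>T\<close> then splits off, and
  \<open>A\<close> and \<open>B\<close> are joined again by their own independence.\<close>

lemma indep_rv_assoc:
  fixes A :: "'a \<Rightarrow> 'b::second_countable_topology"
    and B :: "'a \<Rightarrow> 'c::second_countable_topology"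
    and C :: "'a \<Rightarrow> 'd::second_countable_topology"
  assumes [measurable]: "A \<in> borel_measurable M" "B \<in> borel_measurable M" "C \<in> borel_measurable M"
    and A_BC: "indep_rv M A (\<lambda>\<omega>. (B \<omega>, C \<omega>))"
    and BC: "indep_rv M B C"
  shows "indep_rv M (\<lambda>\<omega>. (A \<omega>, B \<omega>)) C"
proof (subst indep_rv_iff; (intro ballI)?)
  have AB: "indep_rv M A B"
    by (rule indep_rv_fst[OF assms(1-4)])
  fix E :: "('b \<times> 'c) set" and T :: "'d set"
  assume [measurable]: "E \<in> sets borel" "T \<in> sets borel"
  have [measurable]: "E \<in> sets (borel \<Otimes>\<^sub>M borel)"
    unfolding borel_prod by measurable
  have ev: "(\<lambda>\<omega>. (A \<omega>, B \<omega>)) -` E \<inter> space M \<in> sets M" "C -` T \<inter> space M \<in> sets M"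
    by (rule measurable_sets[of _ _ borel]; measurable)+
  have "emeasure M ((\<lambda>\<omega>. (A \<omega>, B \<omega>)) -` E \<inter> space M \<inter> (C -` T \<inter> space M)) =
    (\<integral>\<^sup>+ \<omega>. indicator ((\<lambda>\<omega>. (A \<omega>, B \<omega>)) -` E \<inter> space M \<inter> (C -` T \<inter> space M)) \<omega> \<partial>M)"
    by (rule nn_integral_indicator[symmetric]) (rule sets.Int[OF ev])
  also have "\<dots> = (\<integral>\<^sup>+ \<omega>. indicator E (A \<omega>, B \<omega>) * indicator T (C \<omega>) \<partial>M)"
    by (rule nn_integral_cong) (simp add: indicator_def)
  also have "\<dots> = (\<integral>\<^sup>+ \<omega>. \<integral>\<^sup>+ \<omega>'. indicator E (A \<omega>, B \<omega>') * indicator T (C \<omega>') \<partial>M \<partial>M)"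
    using indep_rv_nn_integral[OF _ _ A_BC,
        of "\<lambda>x. indicator E (fst x, fst (snd x)) * indicator T (snd (snd x))"]
    by (simp add: borel_prod[symmetric])
  also have "\<dots> = (\<integral>\<^sup>+ \<omega>. \<integral>\<^sup>+ \<omega>'. \<integral>\<^sup>+ \<omega>''. indicator E (A \<omega>, B \<omega>') * indicator T (C \<omega>'') \<partial>M \<partial>M \<partial>M)"
    using indep_rv_nn_integral[OF _ _ BC, of "\<lambda>x. indicator E (A \<omega>, fst x) * indicator T (snd x)" for \<omega>]
    by simp
  also have "\<dots> = (\<integral>\<^sup>+ \<omega>. \<integral>\<^sup>+ \<omega>'. indicator E (A \<omega>, B \<omega>') \<partial>M \<partial>M) * (\<integral>\<^sup>+ \<omega>''. indicator T (C \<omega>'') \<partial>M)"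
    by (simp add: nn_integral_cmult nn_integral_multc)
  also have "(\<integral>\<^sup>+ \<omega>. \<integral>\<^sup>+ \<omega>'. indicator E (A \<omega>, B \<omega>') \<partial>M \<partial>M) = (\<integral>\<^sup>+ \<omega>. indicator E (A \<omega>, B \<omega>) \<partial>M)"
    by (rule indep_rv_nn_integral[symmetric]) (use AB in measurable)
  also have "\<dots> = (\<integral>\<^sup>+ \<omega>. indicator ((\<lambda>\<omega>. (A \<omega>, B \<omega>)) -` E \<inter> space M) \<omega> \<partial>M)"
    by (rule nn_integral_cong) (simp add: indicator_def)
  also have "\<dots> = emeasure M ((\<lambda>\<omega>. (A \<omega>, B \<omega>)) -` E \<inter> space M)"
    by (rule nn_integral_indicator) (rule ev)
  also have "(\<integral>\<^sup>+ \<omega>''. indicator T (C \<omega>'') \<partial>M) = (\<integral>\<^sup>+ \<omega>. indicator (C -` T \<inter> space M) \<omega> \<partial>M)"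
    by (rule nn_integral_cong) (simp add: indicator_def)
  also have "\<dots> = emeasure M (C -` T \<inter> space M)"
    by (rule nn_integral_indicator) (rule ev)
  finally show "emeasure M ((\<lambda>\<omega>. (A \<omega>, B \<omega>)) -` E \<inter> space M \<inter> (C -` T \<inter> space M)) =
    emeasure M ((\<lambda>\<omega>. (A \<omega>, B \<omega>)) -` E \<inter> space M) * emeasure M (C -` T \<inter> space M)" .
qed measurable

text \<open>For a fixed value \<open>l\<close> of \<open>L\<close> the cross term is
  \<open>2 * l\<close> times the mean of \<open>D\<close>, which is zero. Extended integrals cover
  an \<open>L\<close> of infinite second moment, as may arise from regressors with unrestricted
  moments.\<close>

lemma nn_integral_square_add_indep:
  fixes D L :: "'a \<Rightarrow> real"
  assumes [measurable]: "D \<in> borel_measurable M" "L \<in> borel_measurable M"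
    and indep: "indep_rv M D L"
    and D: "integrable M D" "expectation D = 0" "integrable M (\<lambda>\<omega>. (D \<omega>)\<^sup>2)"
  shows "(\<integral>\<^sup>+ \<omega>. ennreal ((D \<omega> + L \<omega>)\<^sup>2) \<partial>M) =
    (\<integral>\<^sup>+ \<omega>. ennreal ((D \<omega>)\<^sup>2) \<partial>M) + (\<integral>\<^sup>+ \<omega>. ennreal ((L \<omega>)\<^sup>2) \<partial>M)"
proof -
  have inner: "(\<integral>\<^sup>+ \<omega>. ennreal ((D \<omega> + l)\<^sup>2) \<partial>M) = (\<integral>\<^sup>+ \<omega>. ennreal ((D \<omega>)\<^sup>2) \<partial>M) + ennreal (l\<^sup>2)" for l
  proof -
    have eq: "(\<lambda>\<omega>. (D \<omega> + l)\<^sup>2) = (\<lambda>\<omega>. (D \<omega>)\<^sup>2 + 2 * l * D \<omega> + l\<^sup>2)"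
      by (auto simp: power2_eq_square algebra_simps)
    have "(\<integral>\<^sup>+ \<omega>. ennreal ((D \<omega> + l)\<^sup>2) \<partial>M) = ennreal (expectation (\<lambda>\<omega>. (D \<omega> + l)\<^sup>2))"
      by (rule nn_integral_eq_integral) (use D in \<open>auto simp: eq\<close>)
    also have "expectation (\<lambda>\<omega>. (D \<omega> + l)\<^sup>2) = expectation (\<lambda>\<omega>. (D \<omega>)\<^sup>2) + l\<^sup>2"
      unfolding eq using D by (simp add: prob_space)
    also have "ennreal \<dots> = ennreal (expectation (\<lambda>\<omega>. (D \<omega>)\<^sup>2)) + ennreal (l\<^sup>2)"
      by simp
    also have "ennreal (expectation (\<lambda>\<omega>. (D \<omega>)\<^sup>2)) = (\<integral>\<^sup>+ \<omega>. ennreal ((D \<omega>)\<^sup>2) \<partial>M)"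
      by (rule nn_integral_eq_integral[symmetric]) (use D in auto)
    finally show ?thesis .
  qed
  \<comment> \<open>\<open>D\<close> has to be the inner variable, so independence is taken in the
    reversed order.\<close>
  have "(\<integral>\<^sup>+ \<omega>. ennreal ((D \<omega> + L \<omega>)\<^sup>2) \<partial>M) = (\<integral>\<^sup>+ \<omega>. \<integral>\<^sup>+ \<omega>'. ennreal ((D \<omega>' + L \<omega>)\<^sup>2) \<partial>M \<partial>M)"
    using indep_rv_nn_integral[OF assms(2,1) indep_rv_sym[OF assms(1,2) indep],
        of "\<lambda>x. ennreal ((snd x + fst x)\<^sup>2)"] by simp
  also have "\<dots> = (\<integral>\<^sup>+ \<omega>. ennreal ((D \<omega>)\<^sup>2) \<partial>M) + (\<integral>\<^sup>+ \<omega>. ennreal ((L \<omega>)\<^sup>2) \<partial>M)"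
    unfolding inner by (subst nn_integral_add) (auto simp: emeasure_space_1)
  finally show ?thesis .
qed

text \<open>By independence \<open>B\<close> may vary while \<open>A\<close> is frozen at a typical
  value, and \<open>B\<close> then equals that value almost everywhere.\<close>

lemma AE_const_of_indep_eq:
  fixes A B :: "'a \<Rightarrow> real"
  assumes [measurable]: "A \<in> borel_measurable M" "B \<in> borel_measurable M"
    and indep: "indep_rv M A B" and eq: "AE \<omega> in M. A \<omega> = B \<omega>"
  shows "\<exists>c. AE \<omega> in M. B \<omega> = c"
proof -
  have "AE \<omega> in M. AE \<omega>' in M. A \<omega> = B \<omega>'"
    using indep_rv_AE[OF _ _ indep, of "\<lambda>x. fst x = snd x"] eq by simp
  \<comment> \<open>A probability space is not null, so a property that holds almost everywhere has
    a witness.\<close>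
  then have "\<exists>\<omega>. AE \<omega>' in M. A \<omega> = B \<omega>'"
    using eventually_happens' ae_filter_bot by blast
  then obtain \<omega> where "AE \<omega>' in M. A \<omega> = B \<omega>'" ..
  then show ?thesis by (intro exI[of _ "A \<omega>"]) auto
qed

section \<open>Conditional probabilities and integrals weighted by them\<close>

lemma AE_ennreal_cond_prob:
  assumes sub: "subalgebra M F" and A [measurable]: "A \<in> sets M"
  shows "AE \<omega> in M. nn_cond_exp M F (indicator A) \<omega> = ennreal (real_cond_exp M F (indicator A) \<omega>) \<and>
    nn_cond_exp M F (indicator (space M - A)) \<omega> = ennreal (1 - real_cond_exp M F (indicator A) \<omega>)"
proof -
  interpret finite_measure_subalgebra M F
    by unfold_locales (rule sub)
  have "AE \<omega> in M. nn_cond_exp M F (\<lambda>_. 0) \<omega> = 0"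
    using nn_cond_exp_F_meas[of "\<lambda>_. 0"] by (auto elim: eventually_mono)
  moreover have "AE \<omega> in M. nn_cond_exp M F (\<lambda>_. 1) \<omega> = 1"
    using nn_cond_exp_F_meas[of "\<lambda>_. 1"] by (auto elim: eventually_mono)
  moreover have "AE \<omega> in M. nn_cond_exp M F (indicator A) \<omega> + nn_cond_exp M F (indicator (space M - A)) \<omega>
      = nn_cond_exp M F (\<lambda>\<omega>. indicator A \<omega> + indicator (space M - A) \<omega>) \<omega>"
    by (rule nn_cond_exp_sum) auto
  moreover have "AE \<omega> in M. nn_cond_exp M F (\<lambda>\<omega>. indicator A \<omega> + indicator (space M - A) \<omega>) \<omega>
      = nn_cond_exp M F (\<lambda>_. 1) \<omega>"
    by (rule nn_cond_exp_cong) (auto simp: indicator_def)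
  ultimately show ?thesis
  proof eventually_elim
    case (elim \<omega>)
    \<comment> \<open>\<open>real_cond_exp\<close> subtracts the conditional expectation of the
      negative part, which is zero for an indicator.\<close>
    have "(\<lambda>x. ennreal (- indicator A x)) = (\<lambda>_. 0)" "(\<lambda>x. ennreal (indicator A x)) = indicator A"
      by (auto simp: indicator_def ennreal_neg)
    then have p: "real_cond_exp M F (indicator A) \<omega> = enn2real (nn_cond_exp M F (indicator A) \<omega>)"
      unfolding real_cond_exp_def using elim(1) by simp
    \<comment> \<open>The sum bounds both terms by one, so they are finite and passing through
      \<open>enn2real\<close> loses nothing.\<close>
    have sum: "nn_cond_exp M F (indicator A) \<omega> + nn_cond_exp M F (indicator (space M - A)) \<omega> = 1"
      using elim by simp
    then show ?case
      unfolding p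
      by (cases "nn_cond_exp M F (indicator A) \<omega>"; cases "nn_cond_exp M F (indicator (space M - A)) \<omega>")
        (auto simp flip: ennreal_plus ennreal_1)
  qed
qed

text \<open>The integral is split over \<open>A\<close> and its complement; each weight, being
  nonnegative and measurable for \<open>F\<close>, passes through the conditional expectation. It
  serves to average a loss over the two outcomes of \<open>Y\<close>.\<close>

lemma nn_integral_cond_prob:
  fixes u v :: "'a \<Rightarrow> real"
  assumes sub: "subalgebra M F" and A [measurable]: "A \<in> sets M"
    and u: "u \<in> borel_measurable F" "\<And>\<omega>. 0 \<le> u \<omega>"
    and v: "v \<in> borel_measurable F" "\<And>\<omega>. 0 \<le> v \<omega>"
  defines "p \<equiv> real_cond_exp M F (indicator A)"
  shows "(\<integral>\<^sup>+ \<omega>. ennreal (if \<omega> \<in> A then u \<omega> else v \<omega>) \<partial>M) =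
    (\<integral>\<^sup>+ \<omega>. ennreal (p \<omega>) * ennreal (u \<omega>) + ennreal (1 - p \<omega>) * ennreal (v \<omega>) \<partial>M)"
proof -
  interpret finite_measure_subalgebra M F
    by unfold_locales (rule sub)
  have [measurable]: "u \<in> borel_measurable M" "v \<in> borel_measurable M"
    using u v measurable_from_subalg[OF sub] by auto
  have "(\<integral>\<^sup>+ \<omega>. ennreal (if \<omega> \<in> A then u \<omega> else v \<omega>) \<partial>M) =
    (\<integral>\<^sup>+ \<omega>. ennreal (u \<omega>) * indicator A \<omega> + ennreal (v \<omega>) * indicator (space M - A) \<omega> \<partial>M)"
    by (rule nn_integral_cong) (auto simp: indicator_def)
  also have "\<dots> = (\<integral>\<^sup>+ \<omega>. ennreal (u \<omega>) * indicator A \<omega> \<partial>M) + (\<integral>\<^sup>+ \<omega>. ennreal (v \<omega>) * indicator (space M - A) \<omega> \<partial>M)"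
    by (rule nn_integral_add) auto
  also have "\<dots> = (\<integral>\<^sup>+ \<omega>. ennreal (u \<omega>) * nn_cond_exp M F (indicator A) \<omega> \<partial>M)
      + (\<integral>\<^sup>+ \<omega>. ennreal (v \<omega>) * nn_cond_exp M F (indicator (space M - A)) \<omega> \<partial>M)"
    using u v by (intro arg_cong2[of _ _ _ _ "(+)"] nn_cond_exp_intg[symmetric]) auto
  also have "\<dots> = (\<integral>\<^sup>+ \<omega>. ennreal (u \<omega>) * nn_cond_exp M F (indicator A) \<omega>
      + ennreal (v \<omega>) * nn_cond_exp M F (indicator (space M - A)) \<omega> \<partial>M)"
    by (rule nn_integral_add[symmetric]) auto
  also have "\<dots> = (\<integral>\<^sup>+ \<omega>. ennreal (p \<omega>) * ennreal (u \<omega>) + ennreal (1 - p \<omega>) * ennreal (v \<omega>) \<partial>M)"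
    by (rule nn_integral_cong_AE)
      (use AE_ennreal_cond_prob[OF sub A] in \<open>auto simp: p_def mult.commute\<close>)
  finally show ?thesis .
qed

end

text \<open>The difference \<open>g - f\<close> has integral zero, hence vanishes almost everywhere.
  Finiteness of the integral of \<open>f\<close> legitimises the subtraction of extended
  values.\<close>

lemma AE_eq_of_nn_integral_le:
  fixes f g :: "'a \<Rightarrow> ennreal"
  assumes [measurable]: "f \<in> borel_measurable M" "g \<in> borel_measurable M"
    and le: "AE x in M. f x \<le> g x" and fin: "(\<integral>\<^sup>+ x. f x \<partial>M) < \<infinity>"
    and int: "(\<integral>\<^sup>+ x. g x \<partial>M) \<le> (\<integral>\<^sup>+ x. f x \<partial>M)"
  shows "AE x in M. g x = f x"
proof -
  have "(\<integral>\<^sup>+ x. g x - f x \<partial>M) = (\<integral>\<^sup>+ x. g x \<partial>M) - (\<integral>\<^sup>+ x. f x \<partial>M)"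
    using le fin by (intro nn_integral_diff) auto
  also have "\<dots> = 0"
    using int le_less_trans[OF int fin] by (simp add: diff_eq_0_iff_ennreal)
  finally have "AE x in M. g x - f x = 0"
    by (subst (asm) nn_integral_0_iff_AE) auto
  moreover have "AE x in M. f x \<noteq> \<infinity>"
    using fin by (intro nn_integral_PInf_AE) auto
  ultimately show ?thesis
    using le by eventually_elim (auto simp: diff_eq_0_iff_ennreal)
qed

section \<open>Logistic loss and Gibbs' inequality\<close>

lemma logistic_loss_nonneg: "y \<in> {0, 1} \<Longrightarrow> 0 \<le> logistic_loss y \<eta>"
proof -
  \<comment> \<open>This settles \<open>y = 1\<close>, where the loss is the gap between the two
    sides. Nonnegativity matters because \<open>ennreal\<close> would cut off negative
    losses.\<close>
  have "\<eta> \<le> ln (1 + exp \<eta>)"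
    by (rule ln_ge_iff[THEN iffD2]) (auto intro: add_pos_pos)
  then show "y \<in> {0, 1} \<Longrightarrow> 0 \<le> logistic_loss y \<eta>"
    by (auto simp: logistic_loss_def)
qed

text \<open>The cross entropy of a Bernoulli law with parameter \<open>p\<close> relative to the one
  with log-odds \<open>\<eta>\<close>; it is the conditional mean of the loss when
  \<open>Y = 1\<close> has conditional probability \<open>p\<close>.\<close>

definition expected_logistic_loss :: "real \<Rightarrow> real \<Rightarrow> real" where
  "expected_logistic_loss p \<eta> = p * logistic_loss 1 \<eta> + (1 - p) * logistic_loss 0 \<eta>"

text \<open>The excess over the minimum is the Kullback-Leibler divergence between the Bernoulli
  laws with parameters \<open>p\<close> and \<open>q\<close>, where \<open>q\<close> has log-odds
  \<open>\<eta>\<close>. Bounding both logarithms by \<open>ln x \<le> x - 1\<close> gives bounds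
  that cancel, and this inequality is sharp only at \<open>x = 1\<close>.\<close>

lemma expected_logistic_loss_logit:
  assumes p: "0 < p" "p < 1"
  shows "expected_logistic_loss p (logit p) \<le> expected_logistic_loss p \<eta>"
    and "expected_logistic_loss p \<eta> = expected_logistic_loss p (logit p) \<Longrightarrow> \<eta> = logit p"
proof -
  define q where "q = exp \<eta> / (1 + exp \<eta>)"
  have pos: "0 < 1 + exp \<eta>" by (simp add: add_pos_pos)
  have q1: "1 - q = 1 / (1 + exp \<eta>)" using pos by (simp add: q_def field_simps)
  have q: "0 < q" "q < 1" using pos by (simp_all add: q_def)
  have \<eta>: "\<eta> = logit q"
    unfolding logit_def q1 using pos by (simp add: q_def)
  have loss: "expected_logistic_loss s (logit r) = - s * ln r - (1 - s) * ln (1 - r)"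
    if "0 < r" "r < 1" for s r
  proof -
    have e: "exp (logit r) = r / (1 - r)" using that by (simp add: logit_def)
    have "1 + exp (logit r) = 1 / (1 - r)" unfolding e using that by (simp add: field_simps)
    then have "ln (1 + exp (logit r)) = - ln (1 - r)" using that by (simp add: ln_div)
    then show ?thesis
      using that by (simp add: expected_logistic_loss_def logistic_loss_def logit_def ln_div algebra_simps)
  qed
  have gap: "expected_logistic_loss p (logit p) - expected_logistic_loss p \<eta>
      = p * ln (q / p) + (1 - p) * ln ((1 - q) / (1 - p))"
    unfolding \<eta> using p q by (simp add: loss ln_div algebra_simps)
  have a: "p * ln (q / p) \<le> q - p"
  proof -
    have "p * ln (q / p) \<le> p * (q / p - 1)"
      using p q by (intro mult_left_mono ln_le_minus_one) auto
    then show ?thesis using p by (simp add: algebra_simps)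
  qed
  have b: "(1 - p) * ln ((1 - q) / (1 - p)) \<le> p - q"
  proof -
    have "(1 - p) * ln ((1 - q) / (1 - p)) \<le> (1 - p) * ((1 - q) / (1 - p) - 1)"
      using p q by (intro mult_left_mono ln_le_minus_one) auto
    also have "\<dots> = p - q" using p by (simp add: field_simps)
    finally show ?thesis .
  qed
  show "expected_logistic_loss p (logit p) \<le> expected_logistic_loss p \<eta>"
    using gap a b by simp
  assume "expected_logistic_loss p \<eta> = expected_logistic_loss p (logit p)"
  \<comment> \<open>A zero gap leaves no slack in \<open>a\<close> and \<open>b\<close>; equality in
    \<open>a\<close> alone already fixes \<open>q\<close>.\<close>
  then have "p * ln (q / p) = q - p" using gap a b by simp
  then have "ln (q / p) = q / p - 1" using p by (simp add: field_simps)
  then have "q / p = 1" using p q by (intro ln_eq_minus_one) auto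
  then show "\<eta> = logit p" using p \<eta> by simp
qed

section \<open>Population minimisers of the two regressions and their uniqueness\<close>

context prob_space
begin

text \<open>The risk of a candidate exceeds that of the true coefficients by the second moment of an
  affine function of \<open>(Z, C)\<close>, which a minimiser must make vanish. The conclusion
  concerns the residual, since nothing else of the first stage enters the second.\<close>

lemma first_stage_fit_and_residual:
  fixes Z :: "'a \<Rightarrow> real^'p" and C :: "'a \<Rightarrow> real^'q" and X D :: "'a \<Rightarrow> real"
  assumes [measurable]: "Z \<in> borel_measurable M" "C \<in> borel_measurable M"
      "X \<in> borel_measurable M" "D \<in> borel_measurable M"
    and indep: "indep_rv M D (\<lambda>\<omega>. (C \<omega>, Z \<omega>))"
    and D: "integrable M D" "expectation D = 0" "integrable M (\<lambda>\<omega>. (D \<omega>)\<^sup>2)"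
    and X: "AE \<omega> in M. X \<omega> = \<beta>0 + \<beta>Z \<bullet> Z \<omega> + \<beta>C \<bullet> C \<omega> + D \<omega>"
  shows "first_stage_fit M Z C X \<beta>0 \<beta>Z \<beta>C"
    and "first_stage_fit M Z C X b0 bZ bC \<Longrightarrow>
      AE \<omega> in M. first_stage_residual Z C X b0 bZ bC \<omega> = D \<omega>"
proof -
  \<comment> \<open>\<open>L\<close> is the true linear part minus the candidate one, so that a
    candidate's residual is \<open>D\<close> plus \<open>L\<close>.\<close>
  define L where "L b0 bZ bC \<omega> = (\<beta>0 - b0) + (\<beta>Z - bZ) \<bullet> Z \<omega> + (\<beta>C - bC) \<bullet> C \<omega>" for b0 bZ bC \<omega>
  have [measurable]: "L b0 bZ bC \<in> borel_measurable M" for b0 bZ bC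
    unfolding L_def by measurable
  have res: "AE \<omega> in M. first_stage_residual Z C X b0 bZ bC \<omega> = D \<omega> + L b0 bZ bC \<omega>" for b0 bZ bC
    using X by eventually_elim (simp add: first_stage_residual_def L_def algebra_simps)
  have D_L: "indep_rv M D (L b0 bZ bC)" for b0 bZ bC
  proof -
    have CZ: "(\<lambda>\<omega>. (C \<omega>, Z \<omega>)) \<in> borel_measurable M" by measurable
    have \<psi>: "(\<lambda>x. (\<beta>0 - b0) + (\<beta>Z - bZ) \<bullet> snd x + (\<beta>C - bC) \<bullet> fst x) \<in> borel_measurable borel"
      by (intro borel_measurable_continuous_onI continuous_intros)
    show ?thesis
      using indep_rv_compose[OF assms(4) CZ indep measurable_ident \<psi>]
      by (simp only: L_def[abs_def] id_def fst_conv snd_conv)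
  qed
  have risk: "first_stage_risk M Z C X b0 bZ bC =
    (\<integral>\<^sup>+ \<omega>. ennreal ((D \<omega>)\<^sup>2) \<partial>M) + (\<integral>\<^sup>+ \<omega>. ennreal ((L b0 bZ bC \<omega>)\<^sup>2) \<partial>M)" for b0 bZ bC
  proof -
    have "first_stage_risk M Z C X b0 bZ bC = (\<integral>\<^sup>+ \<omega>. ennreal ((D \<omega> + L b0 bZ bC \<omega>)\<^sup>2) \<partial>M)"
      unfolding first_stage_risk_def
      by (rule nn_integral_cong_AE, use res[of b0 bZ bC] in eventually_elim) simp
    then show ?thesis
      using nn_integral_square_add_indep[OF _ _ D_L D] by simp
  qed
  have risk0: "first_stage_risk M Z C X \<beta>0 \<beta>Z \<beta>C = (\<integral>\<^sup>+ \<omega>. ennreal ((D \<omega>)\<^sup>2) \<partial>M)"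
    by (simp add: risk L_def)
  show "first_stage_fit M Z C X \<beta>0 \<beta>Z \<beta>C"
    unfolding first_stage_fit_def risk0 by (simp add: risk)
  assume "first_stage_fit M Z C X b0 bZ bC"
  then have "first_stage_risk M Z C X b0 bZ bC \<le> (\<integral>\<^sup>+ \<omega>. ennreal ((D \<omega>)\<^sup>2) \<partial>M)"
    unfolding first_stage_fit_def using risk0 by metis
  \<comment> \<open>Finiteness permits cancelling the second moment of \<open>D\<close> in extended
    arithmetic.\<close>
  moreover have "(\<integral>\<^sup>+ \<omega>. ennreal ((D \<omega>)\<^sup>2) \<partial>M) < \<infinity>"
    using D(3) by (simp add: nn_integral_eq_integral)
  ultimately have "(\<integral>\<^sup>+ \<omega>. ennreal ((L b0 bZ bC \<omega>)\<^sup>2) \<partial>M) = 0"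
    using ennreal_add_left_cancel_le[of _ _ 0] unfolding risk by fastforce
  then have "AE \<omega> in M. L b0 bZ bC \<omega> = 0"
    by (simp add: nn_integral_0_iff_AE)
  with res[of b0 bZ bC] show "AE \<omega> in M. first_stage_residual Z C X b0 bZ bC \<omega> = D \<omega>"
    by eventually_elim simp
qed

text \<open>Since \<open>\<eta>\<close> is measurable for \<open>F\<close>, conditioning on
  \<open>F\<close> replaces the outcome by its conditional probability. That this lies in the unit
  interval lets the two extended products merge into one real cross entropy.\<close>

lemma nn_integral_logistic_loss:
  assumes sub: "subalgebra M F" and A [measurable]: "A \<in> sets M"
    and p: "AE \<omega> in M. 0 < real_cond_exp M F (indicator A) \<omega> \<and> real_cond_exp M F (indicator A) \<omega> < 1"
    and [measurable]: "\<eta> \<in> borel_measurable F"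
  shows "(\<integral>\<^sup>+ \<omega>. ennreal (logistic_loss (indicator A \<omega>) (\<eta> \<omega>)) \<partial>M) =
    (\<integral>\<^sup>+ \<omega>. ennreal (expected_logistic_loss (real_cond_exp M F (indicator A) \<omega>) (\<eta> \<omega>)) \<partial>M)"
proof -
  have [measurable]: "(\<lambda>\<omega>. logistic_loss y (\<eta> \<omega>)) \<in> borel_measurable F" for y
    unfolding logistic_loss_def by measurable
  have "(\<integral>\<^sup>+ \<omega>. ennreal (logistic_loss (indicator A \<omega>) (\<eta> \<omega>)) \<partial>M) =
    (\<integral>\<^sup>+ \<omega>. ennreal (if \<omega> \<in> A then logistic_loss 1 (\<eta> \<omega>) else logistic_loss 0 (\<eta> \<omega>)) \<partial>M)"
    by (rule nn_integral_cong) (auto simp: indicator_def)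
  also have "\<dots> = (\<integral>\<^sup>+ \<omega>. ennreal (real_cond_exp M F (indicator A) \<omega>) * ennreal (logistic_loss 1 (\<eta> \<omega>))
      + ennreal (1 - real_cond_exp M F (indicator A) \<omega>) * ennreal (logistic_loss 0 (\<eta> \<omega>)) \<partial>M)"
    by (rule nn_integral_cond_prob[OF sub A]) (auto simp: logistic_loss_nonneg)
  also have "\<dots> = (\<integral>\<^sup>+ \<omega>. ennreal (expected_logistic_loss (real_cond_exp M F (indicator A) \<omega>) (\<eta> \<omega>)) \<partial>M)"
  proof (rule nn_integral_cong_AE, use p in eventually_elim)
    case (elim \<omega>)
    then show ?case
      by (simp add: expected_logistic_loss_def logistic_loss_nonneg flip: ennreal_mult ennreal_plus)
  qed
  finally show ?thesis .
qed

text \<open>Gibbs' inequality holds pointwise, so it integrates to minimality of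
  \<open>\<eta>0\<close>. A competitor with no larger risk must attain it almost everywhere, and its
  equality case then identifies the predictor.\<close>

lemma logistic_risk_minimal_iff:
  assumes sub: "subalgebra M F" and A [measurable]: "A \<in> sets M"
    and p: "AE \<omega> in M. 0 < real_cond_exp M F (indicator A) \<omega> \<and> real_cond_exp M F (indicator A) \<omega> < 1 \<and>
      logit (real_cond_exp M F (indicator A) \<omega>) = \<eta>0 \<omega>"
    and \<eta>0: "\<eta>0 \<in> borel_measurable F" and \<eta>: "\<eta> \<in> borel_measurable F"
  defines "R \<equiv> \<lambda>\<eta>. \<integral>\<^sup>+ \<omega>. ennreal (logistic_loss (indicator A \<omega>) (\<eta> \<omega>)) \<partial>M"
  shows "R \<eta>0 \<le> R \<eta>" and "R \<eta> \<le> R \<eta>0 \<Longrightarrow> AE \<omega> in M. \<eta> \<omega> = \<eta>0 \<omega>"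
proof -
  define q where "q = real_cond_exp M F (indicator A)"
  have [measurable]: "q \<in> borel_measurable M"
    unfolding q_def by measurable
  have R: "R \<zeta> = (\<integral>\<^sup>+ \<omega>. ennreal (expected_logistic_loss (q \<omega>) (\<zeta> \<omega>)) \<partial>M)"
    if "\<zeta> \<in> borel_measurable F" for \<zeta>
    unfolding R_def q_def by (rule nn_integral_logistic_loss[OF sub A _ that]) (use p in auto)
  have le: "AE \<omega> in M. ennreal (expected_logistic_loss (q \<omega>) (\<eta>0 \<omega>)) \<le> ennreal (expected_logistic_loss (q \<omega>) (\<zeta> \<omega>))" for \<zeta>
    using p unfolding q_def[symmetric]
    by eventually_elim (metis ennreal_leI expected_logistic_loss_logit(1))
  have min: "R \<eta>0 \<le> R \<zeta>" if "\<zeta> \<in> borel_measurable F" for \<zeta>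
    unfolding R[OF \<eta>0] R[OF that] by (rule nn_integral_mono_AE) (rule le)
  show "R \<eta>0 \<le> R \<eta>" by (rule min[OF \<eta>])
  \<comment> \<open>Comparison with the zero predictor, whose loss is \<open>ln 2\<close> for either
    outcome, shows that the minimal risk is finite whatever the moments of the basis
    functions.\<close>
  have "R (\<lambda>_. 0) = (\<integral>\<^sup>+ \<omega>. ennreal (ln 2) \<partial>M)"
    unfolding R_def by (simp add: logistic_loss_def)
  with min[of "\<lambda>_. 0"] have fin: "R \<eta>0 < \<infinity>"
    by (simp add: emeasure_space_1 le_less_trans[OF _ ennreal_less_top])
  assume "R \<eta> \<le> R \<eta>0"
  have [measurable]: "\<eta>0 \<in> borel_measurable M" "\<eta> \<in> borel_measurable M"
    using \<eta>0 \<eta> measurable_from_subalg[OF sub] by auto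
  have [measurable]: "(\<lambda>\<omega>. expected_logistic_loss (q \<omega>) (\<zeta> \<omega>)) \<in> borel_measurable M"
    if [measurable]: "\<zeta> \<in> borel_measurable M" for \<zeta>
    unfolding expected_logistic_loss_def logistic_loss_def by measurable
  have "AE \<omega> in M. ennreal (expected_logistic_loss (q \<omega>) (\<eta> \<omega>)) = ennreal (expected_logistic_loss (q \<omega>) (\<eta>0 \<omega>))"
    using le[of \<eta>] fin \<open>R \<eta> \<le> R \<eta>0\<close> unfolding R[OF \<eta>0] R[OF \<eta>]
    by (intro AE_eq_of_nn_integral_le) auto
  with p show "AE \<omega> in M. \<eta> \<omega> = \<eta>0 \<omega>"
    unfolding q_def[symmetric]
  proof eventually_elim
    case (elim \<omega>)
    \<comment> \<open>On nonnegative reals \<open>ennreal\<close> is injective, so equality descends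
      to the real losses.\<close>
    have "0 \<le> expected_logistic_loss (q \<omega>) (\<zeta> \<omega>)" for \<zeta>
      using elim by (simp add: expected_logistic_loss_def logistic_loss_nonneg)
    then have "expected_logistic_loss (q \<omega>) (\<eta> \<omega>) = expected_logistic_loss (q \<omega>) (\<eta>0 \<omega>)"
      using elim by simp
    then show ?case
      using elim expected_logistic_loss_logit(2)[of "q \<omega>" "\<eta> \<omega>"] by auto
  qed
qed

text \<open>Meant for the difference of two predictors that agree almost everywhere. The
  coefficients vanish in a forced order: first \<open>t\<close>, by moving the instrument alone,
  then \<open>r\<close>, by independence of \<open>D\<close> and \<open>C\<close>, then
  \<open>c\<close>, by linear independence.\<close>

lemma predictor_zero_imp_coefficients_zero:
  fixes Z :: "'a \<Rightarrow> real^'p" and C :: "'a \<Rightarrow> real^'q" and X D :: "'a \<Rightarrow> real"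
    and f :: "'k1::finite \<Rightarrow> real \<Rightarrow> real" and g :: "'k2::finite \<Rightarrow> real^'q \<Rightarrow> real" and h :: "real \<Rightarrow> real"
  assumes [measurable]: "Z \<in> borel_measurable M" "C \<in> borel_measurable M" "D \<in> borel_measurable M"
      "\<And>j. f j \<in> borel_measurable borel" "\<And>j. g j \<in> borel_measurable borel"
      "h \<in> borel_measurable borel"
    and CD_Z: "indep_rv M (\<lambda>\<omega>. (D \<omega>, C \<omega>)) Z" and D_C: "indep_rv M D C"
    and X: "AE \<omega> in M. X \<omega> = \<beta>0 + \<beta>Z \<bullet> Z \<omega> + \<beta>C \<bullet> C \<omega> + D \<omega>"
    and f: "lin_indep_along_instrument M f (\<lambda>\<omega>. \<beta>0 + \<beta>C \<bullet> C \<omega> + D \<omega>) (\<lambda>\<omega>. \<beta>Z \<bullet> Z \<omega>)"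
    and g: "lin_indep_rv M (with_one (\<lambda>j \<omega>. g j (C \<omega>)))"
    and h: "\<not> (\<exists>c. AE \<omega> in M. h (D \<omega>) = c)"
    and zero: "AE \<omega> in M. linear_predictor f g b t c (X \<omega>) (C \<omega>) + r * h (D \<omega>) = 0"
  shows "t j = 0" "c k = 0" "r = 0"
proof -
  \<comment> \<open>The vanishing of the predictor, with the exposure replaced by its first-stage
    equation, as a property of \<open>((D, C), Z)\<close>.\<close>
  define P where "P x \<longleftrightarrow>
    linear_predictor f g b t c (\<beta>0 + \<beta>C \<bullet> snd (fst x) + fst (fst x) + \<beta>Z \<bullet> snd x) (snd (fst x))
      + r * h (fst (fst x)) = 0" for x :: "(real \<times> (real^'q)) \<times> (real^'p)"
  have "Measurable.pred ((borel \<Otimes>\<^sub>M borel) \<Otimes>\<^sub>M borel) P"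
    unfolding P_def linear_predictor_def by measurable
  then have P: "Measurable.pred (borel \<Otimes>\<^sub>M borel) P"
    by (simp add: borel_prod)
  have "AE \<omega> in M. P ((D \<omega>, C \<omega>), Z \<omega>)"
    using X zero by eventually_elim (simp add: P_def algebra_simps)
  then have "AE \<omega> in M. AE \<omega>' in M. P ((D \<omega>, C \<omega>), Z \<omega>')"
    by (rule indep_rv_AE[OF _ _ CD_Z P, rotated 2]) measurable
  then have "AE \<omega> in M. \<exists>k. AE \<omega>' in M. (\<Sum>j\<in>UNIV. t j * f j (\<beta>0 + \<beta>C \<bullet> C \<omega> + D \<omega> + \<beta>Z \<bullet> Z \<omega>')) = k"
  proof eventually_elim
    case (elim \<omega>)
    show ?case
      \<comment> \<open>With \<open>\<omega>\<close> fixed, the terms in \<open>C\<close> and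
        \<open>D\<close> do not move with the instrument, so the combination of the
        \<open>f j\<close> equals minus their sum.\<close>
      by (rule exI[of _ "- (b + (\<Sum>j\<in>UNIV. c j * g j (C \<omega>)) + r * h (D \<omega>))"], use elim in eventually_elim)
        (simp add: P_def linear_predictor_def algebra_simps)
  qed
  with f have t: "t j = 0" for j
    unfolding lin_indep_along_instrument_def by blast
  have zero': "AE \<omega> in M. b + (\<Sum>j\<in>UNIV. c j * g j (C \<omega>)) + r * h (D \<omega>) = 0"
    using zero by (simp add: linear_predictor_def t)
  show r: "r = 0"
  proof (rule ccontr)
    assume "r \<noteq> 0"
    \<comment> \<open>Solving the relation for the last term makes \<open>h (D \<omega>)\<close> a
      function of \<open>C\<close>, which is independent of \<open>D\<close>; so it would be
      constant, contrary to \<open>h\<close>.\<close>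
    define \<psi> where "\<psi> x = - (b + (\<Sum>j\<in>UNIV. c j * g j x)) / r" for x
    have [measurable]: "\<psi> \<in> borel_measurable borel"
      unfolding \<psi>_def by measurable
    have "AE \<omega> in M. \<psi> (C \<omega>) = h (D \<omega>)"
      using zero' by eventually_elim (use \<open>r \<noteq> 0\<close> in \<open>simp add: \<psi>_def field_simps\<close>)
    moreover have "indep_rv M (\<lambda>\<omega>. \<psi> (C \<omega>)) (\<lambda>\<omega>. h (D \<omega>))"
      by (rule indep_rv_compose) (use indep_rv_sym[OF _ _ D_C] in measurable)
    ultimately have "\<exists>k. AE \<omega> in M. h (D \<omega>) = k"
      by (intro AE_const_of_indep_eq) auto
    with h show False by simp
  qed
  \<comment> \<open>The index \<open>None\<close> carries the intercept, as the coefficient of the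
    constant one.\<close>
  have "AE \<omega> in M. (\<Sum>i\<in>UNIV. case_option b c i * with_one (\<lambda>j \<omega>. g j (C \<omega>)) i \<omega>) = 0"
    using zero' by (simp add: r UNIV_option_conv sum.reindex with_one_def)
  with g have "\<forall>i. case_option b c i = 0"
    unfolding lin_indep_rv_def by blast
  then show "c k = 0"
    by (metis option.simps(5))
  show "t j = 0" by (rule t)
qed

end

theorem theorem10:
  fixes M :: "'w measure"
    and Z :: "'w \<Rightarrow> real^'p" and C :: "'w \<Rightarrow> real^'q" and U :: "'w \<Rightarrow> real^'u"
    and X Y \<epsilon> \<delta>1 \<delta>2 :: "'w \<Rightarrow> real"
    and \<beta>X0 \<beta>Y0 \<rho> :: real
    and \<beta>Z :: "real^'p" and \<beta>C :: "real^'q" and \<beta>U :: "real^'u"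
    and \<theta> :: "'k1::finite \<Rightarrow> real" and \<gamma> :: "'k2::finite \<Rightarrow> real"
    and f :: "'k1 \<Rightarrow> real \<Rightarrow> real" and g :: "'k2 \<Rightarrow> real^'q \<Rightarrow> real" and h :: "real \<Rightarrow> real"
  assumes M: "prob_space M"
    and measurable_rvs:
      "Z \<in> borel_measurable M" "C \<in> borel_measurable M" "U \<in> borel_measurable M"
      "X \<in> borel_measurable M" "Y \<in> borel_measurable M" "\<epsilon> \<in> borel_measurable M"
      "\<delta>2 \<in> borel_measurable M"
    and measurable_basis:
      "\<And>j. f j \<in> borel_measurable borel" "\<And>j. g j \<in> borel_measurable borel"
    and X_continuous: "\<And>x. measure M {\<omega> \<in> space M. X \<omega> = x} = 0"
    and Y_binary: "\<And>\<omega>. \<omega> \<in> space M \<Longrightarrow> Y \<omega> \<in> {0, 1}"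
    and indep_Z_U: "indep_rv M Z U"
    and indep_C: "indep_rv M C (\<lambda>\<omega>. (Z \<omega>, U \<omega>))"
    and indep_\<epsilon>: "indep_rv M \<epsilon> (\<lambda>\<omega>. (Z \<omega>, C \<omega>, U \<omega>))"
    and \<delta>1: "\<delta>1 = (\<lambda>\<omega>. \<beta>U \<bullet> U \<omega> + \<epsilon> \<omega>)"
    and mean_\<epsilon>: "integrable M \<epsilon>" "integral\<^sup>L M \<epsilon> = 0"
    and mean_U: "integral\<^sup>L M (\<lambda>\<omega>. \<beta>U \<bullet> U \<omega>) = 0"
    and square_integrable: "integrable M (\<lambda>\<omega>. (\<delta>1 \<omega>)\<^sup>2)"
    and exposure: "AE \<omega> in M. X \<omega> = \<beta>X0 + \<beta>Z \<bullet> Z \<omega> + \<beta>C \<bullet> C \<omega> + \<delta>1 \<omega>"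
    and direct_effect: "\<beta>Z \<noteq> 0"
    and outcome:
      "AE \<omega> in M.
         (let p = cond_prob_given M (\<lambda>\<omega>. (X \<omega>, C \<omega>, \<delta>1 \<omega>, \<delta>2 \<omega>)) {\<omega> \<in> space M. Y \<omega> = 1} \<omega>
          in 0 < p \<and> p < 1 \<and> logit p = linear_predictor f g \<beta>Y0 \<theta> \<gamma> (X \<omega>) (C \<omega>) + \<delta>2 \<omega>)"
    and no_direct_effect:
      "AE \<omega> in M.
         cond_prob_given M (\<lambda>\<omega>. (Z \<omega>, X \<omega>, C \<omega>, \<delta>1 \<omega>, \<delta>2 \<omega>)) {\<omega> \<in> space M. Y \<omega> = 1} \<omega>
           = cond_prob_given M (\<lambda>\<omega>. (X \<omega>, C \<omega>, \<delta>1 \<omega>, \<delta>2 \<omega>)) {\<omega> \<in> space M. Y \<omega> = 1} \<omega>"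
    and lin_indep_Z: "lin_indep_rv M (\<lambda>i \<omega>. Z \<omega> $ i)"
    and lin_indep_C: "lin_indep_rv M (\<lambda>i \<omega>. C \<omega> $ i)"
    and lin_indep_f: "lin_indep_rv M (with_one (\<lambda>j \<omega>. f j (X \<omega>)))"
    and lin_indep_f_instrument:
      "lin_indep_along_instrument M f (\<lambda>\<omega>. \<beta>X0 + \<beta>C \<bullet> C \<omega> + \<delta>1 \<omega>) (\<lambda>\<omega>. \<beta>Z \<bullet> Z \<omega>)"
    and lin_indep_g: "lin_indep_rv M (with_one (\<lambda>j \<omega>. g j (C \<omega>)))"
    and h_continuous: "continuous_on UNIV h"
    and h_nonconstant: "\<not> (\<exists>c. AE \<omega> in M. h (\<delta>1 \<omega>) = c)"
    and \<delta>2: "AE \<omega> in M. \<delta>2 \<omega> = \<rho> * h (\<delta>1 \<omega>)"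
  shows "(\<exists>b0 bZ bC. first_stage_fit M Z C X b0 bZ bC) \<and>
    (\<forall>b0 bZ bC. first_stage_fit M Z C X b0 bZ bC \<longrightarrow>
       {(t, c, r). \<exists>a. second_stage_fit M C X Y (first_stage_residual Z C X b0 bZ bC) f g h a t c r}
         = {(\<theta>, \<gamma>, \<rho>)})"
proof -
  interpret prob_space M by (rule M)
  note [measurable] = measurable_rvs measurable_basis
  have [measurable]: "h \<in> borel_measurable borel"
    using h_continuous by (rule borel_measurable_continuous_onI)
  have [measurable]: "\<delta>1 \<in> borel_measurable M"
    unfolding \<delta>1 by measurable

  \<comment> \<open>Independence of the first-stage error, the covariate and the instrument\<close>
  have CZ_U: "indep_rv M (\<lambda>\<omega>. (C \<omega>, Z \<omega>)) U"
    by (rule indep_rv_assoc) (use indep_C indep_Z_U in measurable)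
  have CZ [measurable]: "(\<lambda>\<omega>. (C \<omega>, Z \<omega>)) \<in> borel_measurable M"
    by measurable
  have ZCU: "(\<lambda>\<omega>. (Z \<omega>, C \<omega>, U \<omega>)) \<in> borel_measurable M"
    and \<epsilon>U: "(\<lambda>\<omega>. (\<epsilon> \<omega>, U \<omega>)) \<in> borel_measurable M"
    by measurable
  \<comment> \<open>Reordering \<open>(Z, C, U)\<close> to \<open>(U, (C, Z))\<close> puts
    \<open>U\<close> next to \<open>\<epsilon>\<close>, with which it can then be regrouped.\<close>
  have swap: "(\<lambda>x. (snd (snd x), (fst (snd x), fst x))) \<in>
      measurable (borel :: ((real^'p) \<times> (real^'q) \<times> (real^'u)) measure) borel"
    by (intro borel_measurable_continuous_onI continuous_intros)
  have "indep_rv M \<epsilon> (\<lambda>\<omega>. (U \<omega>, (C \<omega>, Z \<omega>)))"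
    using indep_rv_compose[OF measurable_rvs(6) ZCU indep_\<epsilon> measurable_ident swap]
    by (simp only: id_def fst_conv snd_conv)
  then have \<epsilon>U_CZ: "indep_rv M (\<lambda>\<omega>. (\<epsilon> \<omega>, U \<omega>)) (\<lambda>\<omega>. (C \<omega>, Z \<omega>))"
    by (rule indep_rv_assoc[OF measurable_rvs(6,3) CZ _ indep_rv_sym[OF CZ measurable_rvs(3) CZ_U]])
  have lin: "(\<lambda>x. \<beta>U \<bullet> snd x + fst x) \<in> borel_measurable borel"
    by (intro borel_measurable_continuous_onI continuous_intros)
  have \<delta>1_CZ: "indep_rv M \<delta>1 (\<lambda>\<omega>. (C \<omega>, Z \<omega>))"
    using indep_rv_compose[OF \<epsilon>U CZ \<epsilon>U_CZ lin measurable_ident]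
    by (simp only: \<delta>1 id_def fst_conv snd_conv)
  have \<delta>1_C: "indep_rv M \<delta>1 C"
    by (rule indep_rv_fst[OF \<open>\<delta>1 \<in> borel_measurable M\<close> measurable_rvs(2,1) \<delta>1_CZ])
  have C_Z: "indep_rv M C Z"
    by (rule indep_rv_fst[OF measurable_rvs(2,1,3) indep_C])
  \<comment> \<open>Joint independence is required here: \<open>\<delta>1\<close> and
    \<open>C\<close> are to be held fixed together while \<open>Z\<close> varies.\<close>
  have \<delta>1C_Z: "indep_rv M (\<lambda>\<omega>. (\<delta>1 \<omega>, C \<omega>)) Z"
    by (rule indep_rv_assoc) (use \<delta>1_CZ C_Z in measurable)

  \<comment> \<open>Moments of the error and the first stage\<close>
  have \<delta>1_int: "integrable M \<delta>1"
    by (rule square_integrable_imp_integrable) (use square_integrable in auto)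
  \<comment> \<open>The Bochner integral of a non-integrable function is zero by convention, so
    \<open>mean_U\<close> does not by itself give integrability; it comes from the difference of two
    integrable functions.\<close>
  have "integrable M (\<lambda>\<omega>. \<delta>1 \<omega> - \<epsilon> \<omega>)"
    using \<delta>1_int mean_\<epsilon>(1) by simp
  then have "integrable M (\<lambda>\<omega>. \<beta>U \<bullet> U \<omega>)"
    by (simp add: \<delta>1)
  then have \<delta>1_mean: "expectation \<delta>1 = 0"
    unfolding \<delta>1 using mean_\<epsilon> mean_U by simp
  note first_stage = first_stage_fit_and_residual[OF measurable_rvs(1,2,4) _ \<delta>1_CZ \<delta>1_int \<delta>1_mean square_integrable exposure]

  \<comment> \<open>The outcome model as a conditional probability\<close>
  define A where "A = {\<omega> \<in> space M. Y \<omega> = 1}"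
  have A [measurable]: "A \<in> sets M" unfolding A_def by measurable
  \<comment> \<open>\<open>V\<close> collects the conditioning variables of \<open>outcome\<close>,
    and \<open>F\<close> below is the sigma-algebra that they generate.\<close>
  define V where "V = (\<lambda>\<omega>. (X \<omega>, C \<omega>, \<delta>1 \<omega>, \<delta>2 \<omega>))"
  have [measurable]: "V \<in> borel_measurable M" unfolding V_def by measurable
  define F where "F = vimage_algebra (space M) V borel"
  have sub: "subalgebra M F"
    unfolding subalgebra_def F_def by (auto simp: sets_vimage_algebra2)
  have "V \<in> borel_measurable F"
    unfolding F_def by (rule measurable_vimage_algebra1) auto
  then have V: "(\<lambda>\<omega>. \<phi> (V \<omega>)) \<in> borel_measurable F"
    if "\<phi> \<in> borel_measurable (borel \<Otimes>\<^sub>M borel \<Otimes>\<^sub>M borel \<Otimes>\<^sub>M borel)"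
    for \<phi> :: "real \<times> (real^'q) \<times> real \<times> real \<Rightarrow> real"
    using that by (simp add: borel_prod)

  \<comment> \<open>The predictor is formed with \<open>\<delta>1\<close>, a component of
    \<open>V\<close>, which makes it measurable for \<open>F\<close>; a fitted residual also
    involves \<open>Z\<close>, which is not a component of \<open>V\<close>.\<close>
  define \<eta> where "\<eta> a t c r \<omega> = linear_predictor f g a t c (X \<omega>) (C \<omega>) + r * h (\<delta>1 \<omega>)" for a t c r \<omega>
  have \<eta>: "\<eta> a t c r \<in> borel_measurable F" for a t c r
    using V[of "\<lambda>x. linear_predictor f g a t c (fst x) (fst (snd x)) + r * h (fst (snd (snd x)))"]
    by (simp add: \<eta>_def[abs_def] linear_predictor_def V_def)
  have p: "AE \<omega> in M. 0 < real_cond_exp M F (indicator A) \<omega> \<and> real_cond_exp M F (indicator A) \<omega> < 1 \<and>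
      logit (real_cond_exp M F (indicator A) \<omega>) = \<eta> \<beta>Y0 \<theta> \<gamma> \<rho> \<omega>"
    using outcome \<delta>2 unfolding cond_prob_given_def V_def[symmetric] F_def[symmetric] A_def[symmetric]
    by eventually_elim (simp add: Let_def \<eta>_def)
  note second_stage = logistic_risk_minimal_iff[OF sub A p \<eta> \<eta>]

  \<comment> \<open>Uniqueness of the second-stage parameters\<close>
  have "{(t, c, r). \<exists>a. second_stage_fit M C X Y (first_stage_residual Z C X b0 bZ bC) f g h a t c r}
      = {(\<theta>, \<gamma>, \<rho>)}" if fit: "first_stage_fit M Z C X b0 bZ bC" for b0 bZ bC
  proof -
    let ?D = "first_stage_residual Z C X b0 bZ bC"
    have D: "AE \<omega> in M. ?D \<omega> = \<delta>1 \<omega>"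
      using fit by (intro first_stage) auto
    \<comment> \<open>The risk is insensitive to null sets, so the residual may be replaced by
      \<open>\<delta>1\<close>; the binary \<open>Y\<close> is the indicator of
      \<open>A\<close>.\<close>
    have risk: "second_stage_risk M C X Y ?D f g h a t c r =
        (\<integral>\<^sup>+ \<omega>. ennreal (logistic_loss (indicator A \<omega>) (\<eta> a t c r \<omega>)) \<partial>M)" for a t c r
      unfolding second_stage_risk_def
    proof (rule nn_integral_cong_AE, use D AE_space in eventually_elim)
      case (elim \<omega>)
      then show ?case using Y_binary[of \<omega>] by (auto simp: A_def \<eta>_def)
    qed
    \<comment> \<open>The true parameters attain the minimum, with \<open>\<beta>Y0\<close> as the
      witness for the intercept.\<close>
    have "second_stage_fit M C X Y ?D f g h \<beta>Y0 \<theta> \<gamma> \<rho>"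
      unfolding second_stage_fit_def risk using second_stage(1) by blast
    moreover have "t = \<theta> \<and> c = \<gamma> \<and> r = \<rho>" if "second_stage_fit M C X Y ?D f g h a t c r" for a t c r
    proof -
      have "AE \<omega> in M. \<eta> a t c r \<omega> = \<eta> \<beta>Y0 \<theta> \<gamma> \<rho> \<omega>"
        using that unfolding second_stage_fit_def risk by (intro second_stage(2)) blast
      \<comment> \<open>Predictors are linear in their coefficients, so the difference of two is the
        predictor of the coefficient differences.\<close>
      then have "AE \<omega> in M. linear_predictor f g (a - \<beta>Y0) (\<lambda>j. t j - \<theta> j) (\<lambda>j. c j - \<gamma> j) (X \<omega>) (C \<omega>)
          + (r - \<rho>) * h (\<delta>1 \<omega>) = 0"
        by eventually_elim
          (simp add: \<eta>_def linear_predictor_def algebra_simps sum_subtractf)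
      note predictor_zero_imp_coefficients_zero[OF measurable_rvs(1,2) _ measurable_basis _ \<delta>1C_Z \<delta>1_C
          exposure lin_indep_f_instrument lin_indep_g h_nonconstant this]
      then show ?thesis by (auto simp: fun_eq_iff)
    qed
    ultimately show ?thesis by blast
  qed
  then show ?thesis
    \<comment> \<open>The true first-stage coefficients attain the minimum, so the quantification
      over fits is not vacuous.\<close>
    using first_stage(1) by auto
qed

end
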